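(* Let $P:\mathbb{R}^N\to\mathbb{R}^n$ be a cubic map and assume that: (i) $N\ge n+1$; (ii) if $e_1,\dots,e_N$ denotes the canonical basis of $\mathbb{R}^N$, then for every non-zero $\lambda\in(\mathbb{R}^n)^*$ the quadratic forms $Q_i^\lambda:\mathbb{R}^N\to\mathbb{R}$, $i=1,\dots,N$, $$Q_i^\lambda(x)=\lambda\, d^3P(e_i,x,x),$$ do not have common isotropic vectors $x\neq0$. Then $P$ has a regular zero.
   Context: A cubic map $P:\mathbb{R}^N\to\mathbb{R}^n$ is a map whose components are homogeneous polynomials of degree $3$, i.e. $P(x)=T(x,x,x)$ for a symmetric trilinear map $T:\mathbb{R}^N\times\mathbb{R}^N\times\mathbb{R}^N\to\mathbb{R}^n$. Its differential at $v$ is $d_vP(x)=3T(v,v,x)$, and its third differential is $d^3P(x,y,z)=6T(x,y,z)$. A vector $x$ is isotropic for a quadratic form $Q$ if $Q(x)=0$. A regular zero of $P$ is a $v\in\mathbb{R}^N$ with $P(v)=0$ and $d_vP:\mathbb{R}^N\to\mathbb{R}^n$ surjective. *)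

theory Defs
  imports "HOL-Analysis.Analysis"
begin

definition trilinear ::
  "('a::real_vector \<Rightarrow> 'a \<Rightarrow> 'a \<Rightarrow> 'b::real_vector) \<Rightarrow> bool" where
  "trilinear T \<longleftrightarrow>
     (\<forall>y z. linear (\<lambda>x. T x y z)) \<and>
     (\<forall>x z. linear (\<lambda>y. T x y z)) \<and>
     (\<forall>x y. linear (\<lambda>z. T x y z))"

text \<open>The two transpositions below generate all permutations of the three arguments.\<close>

definition symmetric3 :: "('a \<Rightarrow> 'a \<Rightarrow> 'a \<Rightarrow> 'b) \<Rightarrow> bool" where
  "symmetric3 T \<longleftrightarrow> (\<forall>x y z. T x y z = T y x z \<and> T x y z = T x z y)"

definition cubic_map :: "('a::real_vector \<Rightarrow> 'b::real_vector) \<Rightarrow> bool" where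
  "cubic_map P \<longleftrightarrow> (\<exists>T. trilinear T \<and> symmetric3 T \<and> (\<forall>x. P x = T x x x))"

abbreviation differential ::
  "('a::real_normed_vector \<Rightarrow> 'b::real_normed_vector) \<Rightarrow> 'a \<Rightarrow> 'a \<Rightarrow> 'b" where
  "differential P v \<equiv> frechet_derivative P (at v)"

text \<open>
  The third differential is the iterated Frechet derivative, taken at the origin. For a cubic
  map it does not depend on the base point; lemma \<open>third_differential_cubic\<close> gives its value.
\<close>

definition third_differential ::
  "('a::real_normed_vector \<Rightarrow> 'b::real_normed_vector) \<Rightarrow> 'a \<Rightarrow> 'a \<Rightarrow> 'a \<Rightarrow> 'b" where
  "third_differential P x y z =
     differential (\<lambda>u. differential (\<lambda>v. differential P v x) u y) 0 z"

definition isotropic :: "('a \<Rightarrow> real) \<Rightarrow> 'a \<Rightarrow> bool" where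
  "isotropic Q x \<longleftrightarrow> Q x = 0"

definition regular_zero ::
  "('a::real_normed_vector \<Rightarrow> 'b::real_normed_vector) \<Rightarrow> 'a \<Rightarrow> bool" where
  "regular_zero P v \<longleftrightarrow> P v = 0 \<and> surj (differential P v)"

definition Qform ::
  "(real^'N \<Rightarrow> real^'n) \<Rightarrow> (real^'n \<Rightarrow> real) \<Rightarrow> 'N \<Rightarrow> real^'N \<Rightarrow> real" where
  "Qform P l i x = l (third_differential P (axis i 1) x x)"

lemma has_derivative_cubic:
  fixes T :: "'a::euclidean_space \<Rightarrow> 'a \<Rightarrow> 'a \<Rightarrow> 'b::euclidean_space"
  assumes tri: "trilinear T" and sym: "symmetric3 T"
  shows "((\<lambda>x. T x x x) has_derivative (\<lambda>x. 3 *\<^sub>R T v v x)) (at v)"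
proof -
  have lin: "linear (\<lambda>z. T x y z)" for x y
    using tri by (simp add: trilinear_def)
  have bil: "bounded_bilinear (\<lambda>x y. T x y b)" for b
    using tri by (auto simp: bilinear_conv_bounded_bilinear [symmetric] bilinear_def trilinear_def)
  have expand: "T x y z = (\<Sum>b\<in>Basis. (z \<bullet> b) *\<^sub>R T x y b)" for x y z
  proof -
    have "T x y z = T x y (\<Sum>b\<in>Basis. (z \<bullet> b) *\<^sub>R b)"
      by (simp add: euclidean_representation)
    also have "\<dots> = (\<Sum>b\<in>Basis. (z \<bullet> b) *\<^sub>R T x y b)"
      by (simp add: linear_sum [OF lin] linear_cmul [OF lin])
    finally show ?thesis .
  qed
  have "((\<lambda>x. \<Sum>b\<in>Basis. (x \<bullet> b) *\<^sub>R T x x b) has_derivative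
         (\<lambda>x. \<Sum>b\<in>Basis. (v \<bullet> b) *\<^sub>R (T v x b + T x v b) + (x \<bullet> b) *\<^sub>R T v v b)) (at v)"
    by (auto intro!: derivative_eq_intros bounded_bilinear.FDERIV [OF bil])
  moreover have "(\<Sum>b\<in>Basis. (v \<bullet> b) *\<^sub>R (T v x b + T x v b) + (x \<bullet> b) *\<^sub>R T v v b) = 3 *\<^sub>R T v v x"
    for x
  proof -
    have "(\<Sum>b\<in>Basis. (v \<bullet> b) *\<^sub>R (T v x b + T x v b) + (x \<bullet> b) *\<^sub>R T v v b)
        = T v x v + T x v v + T v v x"
      unfolding expand [of v x v] expand [of x v v] expand [of v v x]
      by (simp add: sum.distrib scaleR_add_right)
    also have "\<dots> = 3 *\<^sub>R T v v x"
    proof -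
      have "T v x v = T v v x" "T x v v = T v v x"
        using sym unfolding symmetric3_def by metis+
      then show ?thesis by (simp add: scaleR_2 [symmetric] scaleR_left_distrib [symmetric]
            scaleR_left_distrib [of 2 1 "T v v x", simplified])
    qed
    finally show ?thesis .
  qed
  ultimately show ?thesis
    by (simp add: expand [symmetric])
qed

lemma differential_cubic:
  fixes T :: "'a::euclidean_space \<Rightarrow> 'a \<Rightarrow> 'a \<Rightarrow> 'b::euclidean_space"
  assumes "trilinear T" "symmetric3 T"
  shows "differential (\<lambda>x. T x x x) v x = 3 *\<^sub>R T v v x"
  using frechet_derivative_at [OF has_derivative_cubic [OF assms, of v]] by metis

lemma second_differential_cubic:
  fixes T :: "'a::euclidean_space \<Rightarrow> 'a \<Rightarrow> 'a \<Rightarrow> 'b::euclidean_space"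
  assumes "trilinear T" "symmetric3 T"
  shows "differential (\<lambda>v. differential (\<lambda>x. T x x x) v x) u y = 6 *\<^sub>R T u x y"
proof -
  have bil: "bounded_bilinear (\<lambda>u v. T u v x)"
    using assms(1)
    by (auto simp: bilinear_conv_bounded_bilinear [symmetric] bilinear_def trilinear_def)
  have s: "T u y x = T u x y" "T y u x = T u x y" for y
    using assms(2) unfolding symmetric3_def by metis+
  have "((\<lambda>v. 3 *\<^sub>R T v v x) has_derivative (\<lambda>y. 3 *\<^sub>R (T u y x + T y u x))) (at u)"
    by (auto intro!: derivative_eq_intros bounded_bilinear.FDERIV [OF bil])
  then have "((\<lambda>v. 3 *\<^sub>R T v v x) has_derivative (\<lambda>y. 6 *\<^sub>R T u x y)) (at u)"
    by (simp add: s scaleR_2 [symmetric])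
  from frechet_derivative_at [OF this] show ?thesis
    unfolding differential_cubic [OF assms] by metis
qed

lemma third_differential_cubic_at:
  fixes T :: "'a::euclidean_space \<Rightarrow> 'a \<Rightarrow> 'a \<Rightarrow> 'b::euclidean_space"
  assumes "trilinear T" "symmetric3 T"
  shows "differential (\<lambda>u. differential (\<lambda>v. differential (\<lambda>x. T x x x) v x) u y) w z
         = 6 *\<^sub>R T x y z"
proof -
  have "linear (\<lambda>u. T u x y)"
    using assms(1) by (simp add: trilinear_def)
  then have "((\<lambda>u. 6 *\<^sub>R T u x y) has_derivative (\<lambda>z. 6 *\<^sub>R T z x y)) (at w)"
    by (intro has_derivative_scaleR_right linear_imp_has_derivative)
  moreover have "T z x y = T x y z" for z
    using assms(2) unfolding symmetric3_def by metis
  ultimately have "((\<lambda>u. 6 *\<^sub>R T u x y) has_derivative (\<lambda>z. 6 *\<^sub>R T x y z)) (at w)"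
    by simp
  from frechet_derivative_at [OF this] show ?thesis
    unfolding second_differential_cubic [OF assms] by metis
qed

lemma third_differential_cubic:
  fixes T :: "'a::euclidean_space \<Rightarrow> 'a \<Rightarrow> 'a \<Rightarrow> 'b::euclidean_space"
  assumes "trilinear T" "symmetric3 T"
  shows "third_differential (\<lambda>x. T x x x) x y z = 6 *\<^sub>R T x y z"
  unfolding third_differential_def by (rule third_differential_cubic_at [OF assms])

end

theory Submission
  imports Defs "HOL-Library.Function_Algebras" "Jordan_Normal_Form.Char_Poly"
begin

text \<open>
  Condition (ii) says that \<open>P\<close> is a submersion away from the origin, so it is enough to find a
  nonzero zero of \<open>P\<close>. Any \<open>n\<close> real cubic forms in more than \<open>n\<close> variables have one. Setting one
  variable to \<open>1\<close> and perturbing, it suffices by compactness of the sphere to solve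
  \<open>e x\<^sub>i\<^sup>3 + p\<^sub>i(x) = 0\<close> for arbitrarily small \<open>e > 0\<close>, where \<open>deg p\<^sub>i \<le> 3\<close>. Reading these polynomials
  as linear recurrences for functions \<open>u\<close> on multi-indices, the solution space is
  for all but countably many \<open>e\<close> parametrised by the values of \<open>u\<close> on \<open>{0,1,2}\<^sup>n\<close>, hence of odd
  dimension \<open>3\<^sup>n\<close>. Commuting operators on a real space of odd dimension have a common
  eigenvector; for the coordinate shifts its eigenvalues form a real solution.
\<close>

section \<open>Linear algebra\<close>

lemma odd_degree_imp_real_root:
  fixes p :: "real poly"
  assumes "odd (degree p)"
  shows "\<exists>x. poly p x = 0"
proof -
  have pos: "\<exists>x. poly p x = 0" if odd: "odd (degree p)" and lc: "lead_coeff p > 0" for p :: "real poly"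
  proof -
    \<comment> \<open>\<open>- p(-x)\<close> keeps the leading coefficient because the degree is
      odd; its positivity at a large \<open>a\<close> gives \<open>poly p (- a) < 0\<close>.\<close>
    define q where "q = - (p \<circ>\<^sub>p [:0, -1:])"
    have "lead_coeff q = lead_coeff p"
      using lead_coeff_comp [of "[:0, -1:]" p] odd by (simp add: q_def del: degree_pcompose)
    then obtain m where m: "\<And>x. x \<ge> m \<Longrightarrow> poly q x > 0"
      using poly_pinfty_gt_lc [of q] lc by fastforce
    obtain n where n: "\<And>x. x \<ge> n \<Longrightarrow> poly p x > 0"
      using poly_pinfty_gt_lc [of p] lc by fastforce
    define a where "a = max 1 (max m n)"
    have "a > 0" "poly q a > 0" "poly p a > 0"
      by (auto intro: m n simp: a_def)
    then have "poly p (- a) < 0"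
      by (simp add: q_def poly_pcompose)
    then show ?thesis
      using poly_IVT_pos [of "- a" a p] \<open>poly p a > 0\<close> \<open>a > 0\<close> by auto
  qed
  show ?thesis
  proof (cases "lead_coeff p > 0")
    case True
    then show ?thesis using pos assms by blast
  next
    case False
    then have "lead_coeff (- p) > 0"
      using assms by (cases "p = 0") (auto simp: not_less order_le_less)
    then show ?thesis using pos [of "- p"] assms by auto
  qed
qed

text \<open>The matrix of \<open>f\<close> on a basis of \<open>V\<close> has a characteristic
  polynomial of odd degree, hence a real eigenvalue.\<close>

lemma invariant_odd_dim_imp_eigenvector:
  fixes f :: "'a::euclidean_space \<Rightarrow> 'a"
  assumes f: "linear f" and V: "subspace V" "f ` V \<subseteq> V" "odd (dim V)"
  shows "\<exists>v\<in>V. v \<noteq> 0 \<and> (\<exists>c. f v = c *\<^sub>R v)"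
proof -
  define d where "d = dim V"
  obtain B where B: "B \<subseteq> V" "independent B" "V \<subseteq> span B" "card B = d"
    unfolding d_def by (rule basis_exists)
  have finB: "finite B"
    using B(2) by (rule independent_imp_finite)
  obtain b where b: "bij_betw b {0..<d} B"
    using ex_bij_betw_nat_finite [OF finB] B(4) by auto
  have sumb: "(\<Sum>x\<in>B. g x *\<^sub>R x) = (\<Sum>i<d. g (b i) *\<^sub>R b i)" for g :: "'a \<Rightarrow> real"
    using sum.reindex_bij_betw [OF b, of "\<lambda>x. g x *\<^sub>R x"] by (simp add: atLeast0LessThan)
  have bB: "b i \<in> B" if "i < d" for i
    using b that by (auto simp: bij_betw_def)
  have "\<exists>g. f (b j) = (\<Sum>i<d. g i *\<^sub>R b i)" if "j < d" for j
  proof -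
    have "f (b j) \<in> span B"
      using V(2) B(1,3) bB [OF that] by blast
    then obtain g where "f (b j) = (\<Sum>x\<in>B. g x *\<^sub>R x)"
      unfolding span_finite [OF finB] by auto
    then show ?thesis
      unfolding sumb by (rule exI [of _ "\<lambda>i. g (b i)"])
  qed
  then obtain g where g: "\<And>j. j < d \<Longrightarrow> f (b j) = (\<Sum>i<d. g j i *\<^sub>R b i)"
    by metis
  define M where "M = mat d d (\<lambda>(i, j). g j i)"
  have M: "M \<in> carrier_mat d d"
    by (simp add: M_def)
  obtain c where "poly (char_poly M) c = 0"
    using odd_degree_imp_real_root [of "char_poly M"] degree_monic_char_poly [OF M] V(3)
    by (auto simp: d_def)
  then obtain x where x: "x \<in> carrier_vec d" "x \<noteq> 0\<^sub>v d" "M *\<^sub>v x = c \<cdot>\<^sub>v x"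
    using eigenvalue_root_char_poly [OF M] M by (auto simp: eigenvalue_def eigenvector_def)
  define v where "v = (\<Sum>j<d. vec_index x j *\<^sub>R b j)"
  have Mx: "(\<Sum>j<d. vec_index x j * g j i) = c * vec_index x i" if "i < d" for i
  proof -
    have "vec_index (M *\<^sub>v x) i = c * vec_index x i"
      using x that by simp
    then show ?thesis
      using x(1) M that by (simp add: M_def scalar_prod_def atLeast0LessThan mult.commute)
  qed
  have "f v = (\<Sum>j<d. vec_index x j *\<^sub>R (\<Sum>i<d. g j i *\<^sub>R b i))"
    by (simp add: v_def linear_sum [OF f] linear_cmul [OF f] g)
  also have "\<dots> = (\<Sum>i<d. (\<Sum>j<d. vec_index x j * g j i) *\<^sub>R b i)"
    by (simp add: scaleR_sum_right scaleR_sum_left) (rule sum.swap)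
  also have "\<dots> = c *\<^sub>R v"
    by (simp add: Mx v_def scaleR_sum_right)
  finally have "f v = c *\<^sub>R v" .
  moreover have "v \<in> V"
    using B(1) bB by (auto simp: v_def intro!: subspace_sum subspace_scale V(1))
  moreover have "v \<noteq> 0"
  proof
    assume "v = 0"
    define h where "h y = vec_index x (inv_into {0..<d} b y)" for y
    have h: "h (b i) = vec_index x i" if "i < d" for i
      using that b by (simp add: h_def bij_betw_def)
    have "(\<Sum>y\<in>B. h y *\<^sub>R y) = 0"
      using \<open>v = 0\<close> by (simp add: sumb h v_def)
    then have "vec_index x i = 0" if "i < d" for i
      using independentD [OF B(2) finB order_refl, of h "b i"] bB [OF that] h [OF that] by simp
    then have "x = 0\<^sub>v d"
      using x(1) by auto
    with x(2) show False by simp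
  qed
  ultimately show ?thesis by blast
qed

text \<open>Rank-nullity on \<open>V\<close>: the orthogonal complement \<open>W\<close> of the
  kernel in \<open>V\<close> has the same image as \<open>V\<close>, and \<open>f\<close> is
  injective on it.\<close>

lemma dim_kernel_plus_dim_image:
  fixes f :: "'a::euclidean_space \<Rightarrow> 'b::euclidean_space"
  assumes f: "linear f" and V: "subspace V"
  shows "dim {x\<in>V. f x = 0} + dim (f ` V) = dim V"
proof -
  define K where "K = {x\<in>V. f x = 0}"
  define W where "W = {y\<in>V. \<forall>x\<in>K. real_inner_class.orthogonal x y}"
  have K: "subspace K"
    using V f by (auto simp: K_def subspace_def linear_0 linear_add linear_cmul)
  have W: "subspace W"
    using V by (auto simp: W_def subspace_def orthogonal_clauses)
  have "f ` V \<subseteq> f ` W"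
  proof
    fix z assume "z \<in> f ` V"
    then obtain v where v: "v \<in> V" "z = f v" by blast
    obtain y w where yw: "y \<in> span K" "\<And>u. u \<in> span K \<Longrightarrow> real_inner_class.orthogonal w u" "v = y + w"
      using orthogonal_subspace_decomp_exists [of K v] by blast
    have "y \<in> K"
      using yw(1) K by (metis span_eq_iff)
    then have "w \<in> V"
      using yw(3) v(1) V subspace_diff [of V v y] by (auto simp: K_def)
    then have "w \<in> W"
      using yw(2) by (auto simp: W_def span_base orthogonal_commute)
    moreover have "f v = f w"
      using \<open>y \<in> K\<close> by (simp add: yw(3) linear_add [OF f] K_def)
    ultimately show "z \<in> f ` W" using v(2) by blast
  qed
  then have "f ` V = f ` W" by (auto simp: W_def)
  moreover have "inj_on f (span W)"
  proof -
    have "x = 0" if "x \<in> W" "f x = 0" for x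
      using that by (auto simp: W_def K_def orthogonal_self)
    then show ?thesis
      using linear_injective_on_subspace_0 [OF f W] W by (metis span_eq_iff)
  qed
  ultimately have "dim (f ` V) = dim W"
    using dim_image_eq [OF f] by simp
  moreover have "dim W + dim K = dim V"
    unfolding W_def by (rule dim_subspace_orthogonal_to_vectors [OF K V]) (auto simp: K_def)
  ultimately show ?thesis
    by (simp add: K_def)
qed

text \<open>
  If some \<open>h = f i - c\<close> is nonzero on \<open>V\<close>, its kernel and its image in \<open>V\<close> are proper invariant
  subspaces whose dimensions add up to an odd number, so one of them has odd dimension.
\<close>

lemma commuting_odd_dim_imp_common_eigenvector:
  fixes f :: "'i \<Rightarrow> 'a::euclidean_space \<Rightarrow> 'a"
  assumes f: "\<And>i. linear (f i)" and comm: "\<And>i j x. f i (f j x) = f j (f i x)"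
    and "subspace V" "\<And>i. f i ` V \<subseteq> V" "odd (dim V)"
  shows "\<exists>v\<in>V. v \<noteq> 0 \<and> (\<forall>i. \<exists>c. f i v = c *\<^sub>R v)"
  using assms(3-)
proof (induction "dim V" arbitrary: V rule: less_induct)
  case less
  show ?case
  proof (cases "\<forall>i. \<exists>c. \<forall>v\<in>V. f i v = c *\<^sub>R v")
    case True
    have "\<not> V \<subseteq> {0}"
      using less.prems(3) by (metis dim_eq_0 even_zero)
    then show ?thesis using True by blast
  next
    case False
    then obtain i where i: "\<And>c. \<exists>v\<in>V. f i v \<noteq> c *\<^sub>R v" by blast
    obtain w c where w: "w \<in> V" "w \<noteq> 0" "f i w = c *\<^sub>R w"
      using invariant_odd_dim_imp_eigenvector [OF f less.prems] by blast
    define h where "h x = f i x - c *\<^sub>R x" for x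
    have h: "linear h"
      unfolding h_def by (intro linear_compose_sub f linear_scale_self)
    have hf: "h (f j x) = f j (h x)" for j x
      by (simp add: h_def comm [of j] linear_diff [OF f] linear_cmul [OF f])
    define K where "K = {x\<in>V. h x = 0}"
    have dims: "dim K + dim (h ` V) = dim V"
      unfolding K_def by (rule dim_kernel_plus_dim_image [OF h less.prems(1)])
    have subK: "subspace K"
      using less.prems(1) h by (auto simp: K_def subspace_def linear_0 linear_add linear_cmul)
    have invK: "f j ` K \<subseteq> K" for j
      using less.prems(2) by (auto simp: K_def hf linear_0 [OF f])
    have subI: "subspace (h ` V)"
      by (rule linear_subspace_image [OF h less.prems(1)])
    have hV: "h ` V \<subseteq> V"
      using less.prems(1,2) by (auto simp: h_def intro!: subspace_diff subspace_scale)
    have invI: "f j ` h ` V \<subseteq> h ` V" for j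
    proof (intro subsetI, elim imageE)
      fix x y z assume "x = f j y" "y = h z" "z \<in> V"
      then have "x = h (f j z)" "f j z \<in> V"
        using less.prems(2) [of j] by (simp_all only: hf, blast)
      then show "x \<in> h ` V" by blast
    qed
    have "\<not> K \<subseteq> {0}"
      using w by (auto simp: K_def h_def)
    then have "dim K > 0"
      by (simp add: dim_eq_0 flip: neq0_conv)
    moreover have "\<not> h ` V \<subseteq> {0}"
      using i [of c] by (auto simp: h_def)
    then have "dim (h ` V) > 0"
      by (simp add: dim_eq_0 flip: neq0_conv)
    ultimately have less_dims: "dim K < dim V" "dim (h ` V) < dim V"
      using dims by auto
    consider "odd (dim K)" | "odd (dim (h ` V))"
      using dims less.prems(3) by (metis even_add)
    then show ?thesis
    proof cases
      case 1
      then show ?thesis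
        using less.hyps [OF less_dims(1) subK invK] by (auto simp: K_def)
    next
      case 2
      then show ?thesis
        using less.hyps [OF less_dims(2) subI invI] hV by blast
    qed
  qed
qed

text \<open>After enumerating \<open>K\<close> the operator is the matrix \<open>e I + M\<close>,
  singular only if \<open>- e\<close> is among the finitely many real roots of the characteristic
  polynomial of \<open>M\<close>.\<close>

lemma shifted_system_uniquely_solvable:
  fixes c :: "'a \<Rightarrow> 'a \<Rightarrow> real"
  assumes K: "finite K"
  defines "L e u a \<equiv> e * u a + (\<Sum>b\<in>K. c a b * u b)"
  shows "finite {e. \<not> ((\<forall>u. (\<forall>a\<in>K. L e u a = 0) \<longrightarrow> (\<forall>a\<in>K. u a = 0)) \<and>
                        (\<forall>g. \<exists>u. \<forall>a\<in>K. L e u a = g a))}"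
proof -
  define d where "d = card K"
  obtain f where f: "bij_betw f {0..<d} K"
    using ex_bij_betw_nat_finite [OF K] by (auto simp: d_def)
  define M where "M = mat d d (\<lambda>(i, j). c (f i) (f j))"
  have M: "M \<in> carrier_mat d d"
    by (simp add: M_def)
  define r where "r = inv_into {0..<d} f"
  have fr: "r a < d" "f (r a) = a" if "a \<in> K" for a
    using f that inv_into_into [of a f "{0..<d}"] f_inv_into_f [of a f "{0..<d}"]
    by (auto simp: bij_betw_def r_def)
  have rf: "r (f i) = i" "f i \<in> K" if "i < d" for i
    using f that by (auto simp: bij_betw_def r_def)
  have sumK: "(\<Sum>b\<in>K. g b) = (\<Sum>j<d. g (f j))" for g :: "'a \<Rightarrow> real"
    using sum.reindex_bij_betw [OF f, of g] by (simp add: atLeast0LessThan)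
  define A where "A e = mat d d (\<lambda>(i, j). (if i = j then e else 0) + c (f i) (f j))" for e
  have A: "A e \<in> carrier_mat d d" for e
    by (simp add: A_def)
  have Ax: "A e *\<^sub>v x = e \<cdot>\<^sub>v x + M *\<^sub>v x" if "x \<in> carrier_vec d" for e x
  proof (rule eq_vecI)
    fix i assume "i < dim_vec (e \<cdot>\<^sub>v x + M *\<^sub>v x)"
    then have i: "i < d"
      by (simp add: M_def)
    have "vec_index (A e *\<^sub>v x) i = (\<Sum>j<d. ((if i = j then e else 0) + c (f i) (f j)) * vec_index x j)"
      using i that by (simp add: A_def scalar_prod_def atLeast0LessThan)
    also have "\<dots> = (\<Sum>j<d. (if i = j then e * vec_index x j else 0) + c (f i) (f j) * vec_index x j)"
      by (intro sum.cong) (auto simp: distrib_right)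
    also have "\<dots> = e * vec_index x i + (\<Sum>j<d. c (f i) (f j) * vec_index x j)"
      using i by (simp add: sum.distrib)
    also have "\<dots> = vec_index (e \<cdot>\<^sub>v x + M *\<^sub>v x) i"
      using i that by (simp add: M_def scalar_prod_def atLeast0LessThan)
    finally show "vec_index (A e *\<^sub>v x) i = vec_index (e \<cdot>\<^sub>v x + M *\<^sub>v x) i" .
  qed (simp add: A_def M_def)
  have AL: "vec_index (A e *\<^sub>v vec d (\<lambda>i. u (f i))) i = L e u (f i)" if "i < d" for e u i
    unfolding Ax [OF vec_carrier] L_def sumK
    using that by (simp add: M_def scalar_prod_def atLeast0LessThan)
  have "poly (char_poly M) (- e) = 0" if detA: "det (A e) = 0" for e
  proof -
    obtain x where x: "x \<in> carrier_vec d" "x \<noteq> 0\<^sub>v d" "A e *\<^sub>v x = 0\<^sub>v d"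
      using detA [unfolded det_0_iff_vec_prod_zero [OF A]] by blast
    have "M *\<^sub>v x = (- e) \<cdot>\<^sub>v x"
    proof (intro eq_vecI)
      fix i assume i: "i < dim_vec ((- e) \<cdot>\<^sub>v x)"
      have "vec_index (e \<cdot>\<^sub>v x + M *\<^sub>v x) i = 0"
        unfolding Ax [OF x(1), symmetric] x(3) using x(1) i by simp
      then show "vec_index (M *\<^sub>v x) i = vec_index ((- e) \<cdot>\<^sub>v x) i"
        using x(1) i M by simp
    qed (use x M in auto)
    then have "eigenvalue M (- e)"
      using x M by (auto simp: eigenvalue_def eigenvector_def)
    then show ?thesis
      by (simp add: eigenvalue_root_char_poly [OF M])
  qed
  then have "{e. det (A e) = 0} \<subseteq> uminus ` {z. poly (char_poly M) z = 0}"
    by (auto intro!: image_eqI [of _ uminus "- _"])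
  moreover have "char_poly M \<noteq> 0"
    using degree_monic_char_poly [OF M] by auto
  ultimately have "finite {e. det (A e) = 0}"
    using poly_roots_finite finite_subset by blast
  moreover have "(\<forall>u. (\<forall>a\<in>K. L e u a = 0) \<longrightarrow> (\<forall>a\<in>K. u a = 0)) \<and> (\<forall>g. \<exists>u. \<forall>a\<in>K. L e u a = g a)"
    if detA: "det (A e) \<noteq> 0" for e
  proof (intro conjI allI impI)
    fix u assume u: "\<forall>a\<in>K. L e u a = 0"
    have "A e *\<^sub>v vec d (\<lambda>i. u (f i)) = 0\<^sub>v d"
      by (rule eq_vecI) (use A u rf in \<open>auto simp: AL simp del: index_mult_mat_vec\<close>)
    then have v0: "vec d (\<lambda>i. u (f i)) = 0\<^sub>v d"
      using detA [unfolded det_0_iff_vec_prod_zero [OF A]] vec_carrier by blast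
    show "\<forall>a\<in>K. u a = 0"
    proof
      fix a assume "a \<in> K"
      then show "u a = 0"
        using arg_cong [OF v0, of "\<lambda>v. vec_index v (r a)"] by (simp add: fr)
    qed
  next
    fix g
    obtain B where B: "B \<in> carrier_mat d d" "A e * B = 1\<^sub>m d"
      using det_non_zero_imp_unit [OF A detA, of "()"] by (auto simp: Units_def ring_mat_def)
    define x where "x = B *\<^sub>v vec d (\<lambda>i. g (f i))"
    have xc: "x \<in> carrier_vec d"
      using B(1) by (simp add: x_def)
    have "A e *\<^sub>v x = vec d (\<lambda>i. g (f i))"
      using assoc_mult_mat_vec [OF A B(1), of "vec d (\<lambda>i. g (f i))" e] B(2) by (simp add: x_def)
    moreover have "vec d (\<lambda>i. vec_index x (r (f i))) = x"
      using xc rf by auto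
    ultimately have Av: "A e *\<^sub>v vec d (\<lambda>i. vec_index x (r (f i))) = vec d (\<lambda>i. g (f i))"
      by simp
    have "L e (\<lambda>a. vec_index x (r a)) a = g a" if "a \<in> K" for a
      using AL [OF fr(1) [OF that], of e "\<lambda>a. vec_index x (r a)"] fr [OF that] Av by simp
    then show "\<exists>u. \<forall>a\<in>K. L e u a = g a" by blast
  qed
  then have "{e. \<not> ((\<forall>u. (\<forall>a\<in>K. L e u a = 0) \<longrightarrow> (\<forall>a\<in>K. u a = 0)) \<and>
                        (\<forall>g. \<exists>u. \<forall>a\<in>K. L e u a = g a))} \<subseteq> {e. det (A e) = 0}"
    by blast
  ultimately show ?thesis
    by (rule rev_finite_subset)
qed

no_notation vec_index (infixl "$" 100)

section \<open>Cubic systems as recurrences\<close>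

definition unit_index :: "nat \<Rightarrow> 'n \<Rightarrow> 'n \<Rightarrow> nat" where
  "unit_index m i = (\<lambda>j. if j = i then m else 0)"

definition monomial_value :: "('n::finite \<Rightarrow> real) \<Rightarrow> ('n \<Rightarrow> nat) \<Rightarrow> real" where
  "monomial_value c a = (\<Prod>i\<in>UNIV. c i ^ a i)"

lemma monomial_value_add: "monomial_value c (a + b) = monomial_value c a * monomial_value c b"
  by (simp add: monomial_value_def power_add prod.distrib)

lemma monomial_value_unit_index: "monomial_value c (unit_index m i) = c i ^ m"
proof -
  have "monomial_value c (unit_index m i) = (\<Prod>j\<in>UNIV. if j = i then c i ^ m else 1)"
    unfolding monomial_value_def by (intro prod.cong) (auto simp: unit_index_def)
  then show ?thesis by simp
qed

lemma unit_index_diff_add: "m \<le> a i \<Longrightarrow> a - unit_index m i + unit_index m i = a"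
  by (auto simp: unit_index_def fun_eq_iff fun_diff_def)

lemma multiplicative_imp_monomial_value:
  fixes u :: "('n::finite \<Rightarrow> nat) \<Rightarrow> real"
  assumes u: "\<And>i a. u (a + unit_index 1 i) = c i * u a"
  shows "u a = monomial_value c a * u 0"
\<comment> \<open>Each step of this induction on the total degree strips one unit from a nonzero
  entry.\<close>
proof (induction "\<Sum>i\<in>UNIV. a i" arbitrary: a rule: less_induct)
  case less
  show ?case
  proof (cases "a = 0")
    case True
    then show ?thesis by (simp add: monomial_value_def)
  next
    case False
    then obtain i where i: "a i \<ge> 1"
      by (auto simp: fun_eq_iff Suc_le_eq)
    define b where "b = a - unit_index 1 i"
    have a: "a = b + unit_index 1 i"
      using unit_index_diff_add [of 1 a i, OF i] by (simp add: b_def)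
    have "(\<Sum>j\<in>UNIV. b j) < (\<Sum>j\<in>UNIV. a j)"
      by (rule sum_strict_mono_ex1) (auto simp: a unit_index_def)
    then have "u b = monomial_value c b * u 0"
      by (rule less)
    then show ?thesis
      by (simp add: a u monomial_value_add monomial_value_unit_index mult.commute mult.left_commute del: One_nat_def)
  qed
qed

lemma finite_degree_le: "finite {a :: 'n::finite \<Rightarrow> nat. (\<Sum>i\<in>UNIV. a i) \<le> D}"
proof (rule finite_subset)
  show "{a :: 'n \<Rightarrow> nat. (\<Sum>i\<in>UNIV. a i) \<le> D} \<subseteq> Pi\<^sub>E UNIV (\<lambda>_. {..D})"
  proof
    fix a :: "'n \<Rightarrow> nat" assume "a \<in> {a. (\<Sum>i\<in>UNIV. a i) \<le> D}"
    moreover have "a i \<le> (\<Sum>i\<in>UNIV. a i)" for i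
      by (rule member_le_sum) auto
    ultimately have "a i \<le> D" for i
      by (metis mem_Collect_eq order_trans)
    then show "a \<in> Pi\<^sub>E UNIV (\<lambda>_. {..D})"
      by (auto simp: PiE_def Pi_def)
  qed
qed (auto intro: finite_PiE)

text \<open>
  The system in question is \<open>e * c\<^sub>i\<^sup>3 + (\<Sum>q. t i q * c\<^sup>s\<^sup>q) = 0\<close> for all \<open>i\<close>. Polynomials act on functions of
  multi-indices by letting the \<open>j\<close>-th variable act as the shift in direction \<open>j\<close>; \<open>S i\<close> and
  \<open>F e i\<close> are the operators of the perturbation and of the whole \<open>i\<close>-th polynomial. The
  injection \<open>r\<close> only serves to order the variables.
\<close>

locale cubic_system =
  fixes r :: "'n::finite \<Rightarrow> nat" and n :: nat
    and s :: "'q::finite \<Rightarrow> 'n \<Rightarrow> nat" and t :: "'n \<Rightarrow> 'q \<Rightarrow> real"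
  assumes inj_r: "inj r" and r_less: "r i < n" and deg_s: "(\<Sum>i\<in>UNIV. s q i) \<le> 3"
begin

abbreviation e3 :: "'n \<Rightarrow> 'n \<Rightarrow> nat" where "e3 \<equiv> unit_index 3"

abbreviation K :: "nat \<Rightarrow> ('n \<Rightarrow> nat) set" where
  "K D \<equiv> {a. (\<Sum>i\<in>UNIV. a i) \<le> D}"

definition S :: "'n \<Rightarrow> (('n \<Rightarrow> nat) \<Rightarrow> real) \<Rightarrow> ('n \<Rightarrow> nat) \<Rightarrow> real" where
  "S i u a = (\<Sum>q\<in>UNIV. t i q * u (a + s q))"

definition F :: "real \<Rightarrow> 'n \<Rightarrow> (('n \<Rightarrow> nat) \<Rightarrow> real) \<Rightarrow> ('n \<Rightarrow> nat) \<Rightarrow> real" where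
  "F e i u a = e * u (a + e3 i) + S i u a"

text \<open>The bound \<open>k\<close> allows an induction over the variables: \<open>k = n\<close>
  admits all of them, \<open>k = r i\<close> only those before \<open>i\<close>.\<close>

definition reducible :: "nat \<Rightarrow> ('n \<Rightarrow> nat) \<Rightarrow> bool" where
  "reducible k a \<longleftrightarrow> (\<exists>j. r j < k \<and> 3 \<le> a j)"

text \<open>Taking the least rank makes the pivot independent of \<open>k\<close>, and of rank below
  \<open>k\<close> whenever \<open>reducible k a\<close>.\<close>

definition pivot :: "('n \<Rightarrow> nat) \<Rightarrow> 'n" where
  "pivot a = (ARG_MIN r j. 3 \<le> a j)"

text \<open>
  With \<open>i = pivot a\<close>, the equation \<open>e * u a + N k u a = 0\<close> is the \<open>i\<close>-th recurrence at
  \<open>a - e3 i\<close>: each reducible multi-index is governed by exactly one recurrence. As \<open>N k\<close> does not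
  raise degrees, \<open>e + N k\<close> is invertible on each \<open>K D\<close> for all but finitely many \<open>e\<close>.
\<close>

definition N :: "nat \<Rightarrow> (('n \<Rightarrow> nat) \<Rightarrow> real) \<Rightarrow> ('n \<Rightarrow> nat) \<Rightarrow> real" where
  "N k u a = (if reducible k a then S (pivot a) u (a - e3 (pivot a)) else 0)"

definition solvable :: "nat \<Rightarrow> nat \<Rightarrow> real \<Rightarrow> bool" where
  "solvable k D e \<longleftrightarrow>
     (\<forall>u. (\<forall>a\<in>K D. e * u a + N k u a = 0) \<longrightarrow> (\<forall>a\<in>K D. u a = 0)) \<and>
     (\<forall>g. \<exists>u. \<forall>a\<in>K D. e * u a + N k u a = g a)"

definition good :: "real \<Rightarrow> bool" where
  "good e \<longleftrightarrow> e \<noteq> 0 \<and> (\<forall>k D. solvable k D e)"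

section \<open>Invertibility of \<open>e + N k\<close>\<close>

lemma pivot: "3 \<le> a j \<Longrightarrow> 3 \<le> a (pivot a) \<and> r (pivot a) \<le> r j"
  unfolding pivot_def using arg_min_nat_lemma [of "\<lambda>j. 3 \<le> a j" j r] by blast

lemma reducible_pivot: "reducible k a \<Longrightarrow> 3 \<le> a (pivot a) \<and> r (pivot a) < k"
  unfolding reducible_def using pivot by (meson le_less_trans)

lemma reducible_n: "reducible n a \<longleftrightarrow> (\<exists>j. 3 \<le> a j)"
  by (simp add: reducible_def r_less)

text \<open>Subtracting \<open>e3\<close> lowers the total degree by 3, and adding
  \<open>s q\<close> restores at most 3.\<close>

lemma reduct_in_K:
  assumes "reducible k a" "a \<in> K D"
  shows "a - e3 (pivot a) + s q \<in> K D"
proof -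
  define b where "b = a - e3 (pivot a)"
  have "b + e3 (pivot a) = a"
    using unit_index_diff_add [of 3 a "pivot a"] reducible_pivot [OF assms(1)] by (simp add: b_def)
  moreover have "(\<Sum>i\<in>UNIV. (b + e3 j) i) = (\<Sum>i\<in>UNIV. b i) + 3" for j
    by (simp add: sum.distrib unit_index_def)
  ultimately have "(\<Sum>i\<in>UNIV. b i) + 3 = (\<Sum>i\<in>UNIV. a i)"
    by metis
  then show ?thesis
    using assms(2) deg_s [of q] by (simp add: sum.distrib flip: b_def)
qed

text \<open>Writes \<open>N k\<close> as a matrix on \<open>K D\<close>, the form required by
  \<open>shifted_system_uniquely_solvable\<close>.\<close>

lemma N_eq_sum:
  assumes "a \<in> K D"
  shows "N k u a = (\<Sum>b\<in>K D. (if reducible k a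
           then \<Sum>q\<in>UNIV. t (pivot a) q * of_bool (b = a - e3 (pivot a) + s q) else 0) * u b)"
proof (cases "reducible k a")
  case True
  have "(\<Sum>b\<in>K D. (\<Sum>q\<in>UNIV. t (pivot a) q * of_bool (b = a - e3 (pivot a) + s q)) * u b)
      = (\<Sum>q\<in>UNIV. t (pivot a) q * (\<Sum>b\<in>K D. of_bool (b = a - e3 (pivot a) + s q) * u b))"
    unfolding sum_distrib_left sum_distrib_right
    by (subst sum.swap) (simp add: mult.assoc)
  also have "\<dots> = (\<Sum>q\<in>UNIV. t (pivot a) q * u (a - e3 (pivot a) + s q))"
  proof (intro sum.cong refl arg_cong [of _ _ "(*) _"])
    fix q
    have "(\<Sum>b\<in>K D. of_bool (b = a - e3 (pivot a) + s q) * u b)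
        = (\<Sum>b\<in>K D. if b = a - e3 (pivot a) + s q then u (a - e3 (pivot a) + s q) else 0)"
      by (intro sum.cong) auto
    also have "\<dots> = u (a - e3 (pivot a) + s q)"
      using reduct_in_K [OF True assms] by (subst sum.delta [OF finite_degree_le]) (rule if_P)
    finally show "(\<Sum>b\<in>K D. of_bool (b = a - e3 (pivot a) + s q) * u b) = u (a - e3 (pivot a) + s q)" .
  qed
  finally show ?thesis using True by (simp only: N_def S_def if_True)
qed (simp add: N_def)

lemma N_cong: "a \<in> K D \<Longrightarrow> (\<And>b. b \<in> K D \<Longrightarrow> u b = v b) \<Longrightarrow> N k u a = N k v a"
  unfolding N_eq_sum by (intro sum.cong) auto

lemma N_diff: "N k (\<lambda>a. u a - v a) a = N k u a - N k v a"
  by (simp add: N_def S_def right_diff_distrib sum_subtractf)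

lemma countable_not_good: "countable {e. \<not> good e}"
proof -
  have "finite {e. \<not> solvable k D e}" for k D
    using shifted_system_uniquely_solvable [OF finite_degree_le]
    unfolding solvable_def by (simp only: N_eq_sum cong: ball_cong)
  then have "countable ({0} \<union> (\<Union>k D. {e. \<not> solvable k D e}))"
    by (intro countable_Un countable_UN) (auto intro: countable_finite)
  moreover have "{e. \<not> good e} = {0} \<union> (\<Union>k D. {e. \<not> solvable k D e})"
    by (auto simp: good_def)
  ultimately show ?thesis by simp
qed

lemma good_imp_zero:
  assumes "good e" "\<forall>a\<in>K D. e * u a + N k u a = 0" "a \<in> K D"
  shows "u a = 0"
proof -
  have "solvable k D e"
    using assms(1) by (simp add: good_def)
  then show ?thesis
    unfolding solvable_def using assms(2,3) by (elim conjE allE [of _ u]) (drule mp, assumption, erule bspec)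
qed

lemma good_imp_solution:
  assumes "good e"
  shows "\<exists>u. \<forall>a\<in>K D. e * u a + N k u a = g a"
proof -
  have "solvable k D e"
    using assms by (simp add: good_def)
  then show ?thesis
    unfolding solvable_def by (elim conjE allE [of _ g])
qed

text \<open>Every multi-index lies in some \<open>K D\<close>, so injectivity on each
  \<open>K D\<close> suffices.\<close>

lemma good_injective:
  assumes "good e" "\<And>a. e * u a + N k u a = 0"
  shows "u a = 0"
  by (rule good_imp_zero [where D = "\<Sum>i\<in>UNIV. a i", OF assms(1)]) (auto intro: assms(2))

text \<open>Solutions on the sets \<open>K D\<close> agree where they overlap, by uniqueness, and
  therefore glue.\<close>

lemma good_surjective:
  assumes "good e"
  shows "\<exists>u. \<forall>a. e * u a + N k u a = g a"
proof -
  have "\<forall>D. \<exists>u. \<forall>a\<in>K D. e * u a + N k u a = g a"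
    by (intro allI good_imp_solution assms)
  from choice [OF this] obtain U where "\<forall>D. \<forall>a\<in>K D. e * U D a + N k (U D) a = g a"
    by blast
  then have U: "e * U D a + N k (U D) a = g a" if "a \<in> K D" for D a
    using that by blast
  have consistent: "U D a = U D' a" if "D \<le> D'" "a \<in> K D" for D D' a
  proof -
    have "e * (U D b - U D' b) + N k (\<lambda>a. U D a - U D' a) b = 0" if b: "b \<in> K D" for b
    proof -
      have "b \<in> K D'" using b \<open>D \<le> D'\<close> by simp
      then show ?thesis
        using U [OF b] U [of b D'] by (simp add: N_diff algebra_simps)
    qed
    then have "U D a - U D' a = 0"
      using \<open>a \<in> K D\<close> by (intro good_imp_zero [OF assms, where D = D]) auto
    then show ?thesis by simp
  qed
  \<comment> \<open>Each \<open>a\<close> is evaluated in the smallest \<open>K D\<close> containing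
    it; \<open>N k\<close> at \<open>a\<close> sees only values on that \<open>K D\<close>.\<close>
  define u where "u a = U (\<Sum>i\<in>UNIV. a i) a" for a
  have "e * u a + N k u a = g a" for a
  proof -
    define D where "D = (\<Sum>i\<in>UNIV. a i)"
    have a: "a \<in> K D" by (simp add: D_def)
    have "N k u a = N k (U D) a"
      by (rule N_cong [OF a]) (simp add: u_def consistent)
    then show ?thesis
      using U [OF a] by (simp add: u_def D_def)
  qed
  then show ?thesis by blast
qed

section \<open>The recurrence operators commute\<close>

lemma F_zero: "F e i (\<lambda>_. 0) a = 0"
  by (simp add: F_def S_def)

lemma F_add: "F e i (\<lambda>a. u a + v a) a = F e i u a + F e i v a"
  by (simp add: F_def S_def algebra_simps sum.distrib)

lemma F_scale: "F e i (\<lambda>a. c * u a) a = c * F e i u a"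
  by (simp add: F_def S_def algebra_simps sum_distrib_left)

lemma F_shift: "F e i (\<lambda>a. u (a + b)) a = F e i u (a + b)"
  by (simp add: F_def S_def algebra_simps)

lemma F_sum: "F e i (\<lambda>a. \<Sum>q\<in>Q. c q * u q a) a = (\<Sum>q\<in>Q. c q * F e i (u q) a)"
proof (induction Q rule: infinite_finite_induct)
  case (insert q Q)
  then show ?case by (simp add: F_add F_scale)
qed (simp_all add: F_zero)

text \<open>Both operators are polynomials in the commuting shifts with constant
  coefficients.\<close>

lemma F_commute: "F e j (F e i u) a = F e i (F e j u) a"
proof -
  have "F e j (F e i u) a = e * F e i u (a + e3 j) + (\<Sum>q\<in>UNIV. t j q * F e i u (a + s q))"
    by (simp add: F_def [of e j] S_def)
  also have "\<dots> = F e i (\<lambda>a. e * u (a + e3 j) + (\<Sum>q\<in>UNIV. t j q * u (a + s q))) a"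
    by (simp add: F_add F_scale F_sum F_shift)
  also have "\<dots> = F e i (F e j u) a"
    by (simp add: F_def [of e j, abs_def] S_def)
  finally show ?thesis .
qed

lemma F_eq_N:
  assumes "reducible k a"
  shows "F e (pivot a) u (a - e3 (pivot a)) = e * u a + N k u a"
  using unit_index_diff_add [of 3 a "pivot a"] reducible_pivot [OF assms] assms by (simp add: F_def N_def)

text \<open>
  For \<open>w = F e i u\<close> and a pivot \<open>j\<close> of smaller rank than \<open>i\<close>, commutativity gives
  \<open>F e j w = F e i (F e j u) = 0\<close>, so \<open>w\<close> lies in the kernel of the injective \<open>e + N (r i)\<close>.
\<close>

lemma reduced_equations_imp_all:
  assumes "good e" and u: "\<And>a. reducible n a \<Longrightarrow> e * u a + N n u a = 0"
  shows "F e i u a = 0"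
proof (induction "r i" arbitrary: i a rule: less_induct)
  case less
  have "e * F e i u a + N (r i) (F e i u) a = 0" for a
  proof (cases "reducible (r i) a")
    case True
    have "F e (pivot a) u = (\<lambda>_. 0)"
      using less reducible_pivot [OF True] by auto
    then show ?thesis
      using F_eq_N [OF True, of e "F e i u"] F_commute [of e "pivot a" i u] by (simp add: F_zero)
  next
    case False
    \<comment> \<open>Here \<open>N (r i)\<close> vanishes at \<open>a\<close>. A pivot of
      \<open>a + e3 i\<close> other than \<open>i\<close> would have smaller rank and the same entry
      in \<open>a\<close>, making \<open>a\<close> reducible; so the pivot is \<open>i\<close> and
      the hypothesis at \<open>a + e3 i\<close> is the claim.\<close>
    have red: "reducible n (a + e3 i)"
      unfolding reducible_n by (intro exI [of _ i]) (simp add: unit_index_def)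
    have "pivot (a + e3 i) = i"
    proof (rule ccontr)
      assume neq: "pivot (a + e3 i) \<noteq> i"
      have "3 \<le> (a + e3 i) (pivot (a + e3 i))" "r (pivot (a + e3 i)) \<le> r i"
        using pivot [of "a + e3 i" i] by (simp_all add: unit_index_def)
      moreover have "r (pivot (a + e3 i)) \<noteq> r i"
        using neq inj_r by (auto dest: injD)
      ultimately have "reducible (r i) a"
        using neq by (auto simp: reducible_def unit_index_def intro!: exI [of _ "pivot (a + e3 i)"])
      with False show False ..
    qed
    then have "F e i u a = e * u (a + e3 i) + N n u (a + e3 i)"
      using F_eq_N [OF red, of e u] by (simp add: add_diff_cancel_right')
    then show ?thesis
      using u [OF red] False by (simp add: N_def)
  qed
  then show ?case
    by (rule good_injective [OF \<open>good e\<close>])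
qed

section \<open>The solution space and its shifts\<close>

definition solutions :: "real \<Rightarrow> (('n \<Rightarrow> nat) \<Rightarrow> real) set" where
  "solutions e = {u. \<forall>i a. F e i u a = 0}"

text \<open>The difference satisfies the reduced equation everywhere: at reducible multi-indices by
  the recurrences, elsewhere because it is zero there. Injectivity of \<open>e + N n\<close>
  finishes.\<close>

lemma solution_eqI:
  assumes "good e" and uv: "u \<in> solutions e" "v \<in> solutions e"
    and eq: "\<And>a. \<forall>i. a i < 3 \<Longrightarrow> u a = v a"
  shows "u = v"
proof -
  have "e * (u a - v a) + N n (\<lambda>a. u a - v a) a = 0" for a
  proof (cases "reducible n a")
    case True
    then show ?thesis
      using F_eq_N [OF True, of e u] F_eq_N [OF True, of e v] uv
      by (simp add: solutions_def N_diff algebra_simps)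
  next
    case False
    then have "u a = v a"
      by (intro eq) (simp add: reducible_n not_le)
    then show ?thesis
      using False by (simp add: N_def)
  qed
  then have "u a - v a = 0" for a
    by (rule good_injective [OF \<open>good e\<close>])
  then show ?thesis by auto
qed

lemma solution_exists:
  assumes "good e"
  shows "\<exists>u\<in>solutions e. \<forall>a. (\<forall>i. a i < 3) \<longrightarrow> u a = g a"
proof -
  \<comment> \<open>The zero right-hand side imposes the recurrences; where \<open>N n\<close>
    vanishes, \<open>e * g a\<close> prescribes \<open>u a = g a\<close>.\<close>
  obtain u where u: "\<And>a. e * u a + N n u a = (if reducible n a then 0 else e * g a)"
    using good_surjective [OF assms, of n "\<lambda>a. if reducible n a then 0 else e * g a"] by blast
  have "u \<in> solutions e"
    unfolding solutions_def using reduced_equations_imp_all [OF assms, of u] u by simp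
  moreover have "u a = g a" if "\<forall>i. a i < 3" for a
  proof -
    have "\<not> reducible n a" using that by (simp add: reducible_n not_le)
    then show ?thesis using u [of a] assms by (simp add: N_def good_def)
  qed
  ultimately show ?thesis by blast
qed

text \<open>
  The sequences killed by all \<open>F e i\<close> form a space of odd dimension \<open>3 ^ CARD('n)\<close> on which the
  coordinate shifts commute; a common eigenvector of the shifts is a geometric sequence whose
  ratios \<open>c\<close> solve the system.
\<close>

theorem good_imp_root:
  assumes "good e"
  shows "\<exists>c. \<forall>i. e * c i ^ 3 + (\<Sum>q\<in>UNIV. t i q * monomial_value c (s q)) = 0"
proof -
  have "{a :: 'n \<Rightarrow> nat. \<forall>i. a i < 3} = Pi\<^sub>E UNIV (\<lambda>_. {..<3})"
    by (auto simp: PiE_def Pi_def)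
  then have "finite {a :: 'n \<Rightarrow> nat. \<forall>i. a i < 3}" "card {a :: 'n \<Rightarrow> nat. \<forall>i. a i < 3} = CARD('n \<Rightarrow> 3)"
    by (simp_all add: finite_PiE card_PiE card_fun)
  \<comment> \<open>\<open>real ^ ('n \<Rightarrow> 3)\<close> is a Euclidean model of the solution
    space: \<open>em\<close> matches its coordinates with the multi-indices having entries in
    \<open>{0,1,2}\<close>.\<close>
  then obtain em :: "('n \<Rightarrow> 3) \<Rightarrow> 'n \<Rightarrow> nat" where em: "bij_betw em UNIV {a. \<forall>i. a i < 3}"
    using finite_same_card_bij [of "UNIV :: ('n \<Rightarrow> 3) set"] by (metis finite_class.finite_UNIV)
  have em_small: "em x i < 3" for x i
    using em by (auto simp: bij_betw_def)
  have em_inv: "em (inv_into UNIV em a) = a" if "\<forall>i. a i < 3" for a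
    using em that by (intro f_inv_into_f [of a em UNIV]) (simp add: bij_betw_def)
  have inv_em: "inv_into UNIV em (em x) = x" for x
    using em by (simp add: bij_betw_def)
  have "\<forall>w :: real ^ ('n \<Rightarrow> 3). \<exists>u. u \<in> solutions e \<and> (\<forall>x. u (em x) = w $ x)"
  proof
    fix w :: "real ^ ('n \<Rightarrow> 3)"
    show "\<exists>u. u \<in> solutions e \<and> (\<forall>x. u (em x) = w $ x)"
      using solution_exists [OF assms, of "\<lambda>a. w $ inv_into UNIV em a"] em_small inv_em by auto
  qed
  \<comment> \<open>\<open>E\<close> extends a table of values to a solution, unique by
    \<open>solution_eqI\<close>; uniqueness makes \<open>E\<close> linear.\<close>
  from choice [OF this]
  obtain E where E: "\<And>w. E w \<in> solutions e" "\<And>w x. E w (em x) = w $ x"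
    by blast
  have E_unique: "E w = u" if "u \<in> solutions e" "\<And>x. u (em x) = w $ x" for u w
  proof (rule solution_eqI [OF assms E(1) that(1)])
    fix a :: "'n \<Rightarrow> nat" assume "\<forall>i. a i < 3"
    then show "E w a = u a"
      using E(2) [of w "inv_into UNIV em a"] that(2) [of "inv_into UNIV em a"] by (simp add: em_inv)
  qed
  have E_add: "E (v + w) = (\<lambda>a. E v a + E w a)" for v w
    by (rule E_unique) (use E(1) in \<open>auto simp: solutions_def F_add E(2)\<close>)
  have E_scale: "E (c *\<^sub>R w) = (\<lambda>a. c * E w a)" for c w
    by (rule E_unique) (use E(1) in \<open>auto simp: solutions_def F_scale E(2)\<close>)
  \<comment> \<open>The shift in direction \<open>i\<close>, transported to tables of values by
    \<open>E\<close>.\<close>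
  define X where "X i w = (\<chi> x. E w (em x + unit_index 1 i))" for i w
  have EX: "E (X i w) = (\<lambda>a. E w (a + unit_index 1 i))" for i w
    by (rule E_unique) (use E(1) in \<open>auto simp: solutions_def F_shift X_def\<close>)
  have "linear (X i)" for i
    by (rule linearI) (simp_all add: X_def E_add E_scale Finite_Cartesian_Product.vec_eq_iff)
  moreover have "X i (X j w) = X j (X i w)" for i j w
    unfolding X_def [of i "X j w"] X_def [of j "X i w"] EX by (simp add: ac_simps)
  moreover have "odd (dim (UNIV :: (real ^ ('n \<Rightarrow> 3)) set))"
    by (simp add: dim_UNIV card_fun)
  ultimately obtain v where v: "v \<noteq> 0" "\<And>i. \<exists>c. X i v = c *\<^sub>R v"
    using commuting_odd_dim_imp_common_eigenvector [of X UNIV] by auto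
  then obtain c where c: "\<And>i. X i v = c i *\<^sub>R v"
    by metis
  define u where "u = E v"
  have "u (a + unit_index 1 i) = c i * u a" for i a
    using fun_cong [OF EX [of i v], of a] by (simp add: c E_scale u_def)
  then have geometric: "u a = monomial_value c a * u 0" for a
    by (rule multiplicative_imp_monomial_value)
  have "u 0 \<noteq> 0"
  proof
    assume "u 0 = 0"
    then have "v $ x = 0" for x
      using geometric E(2) [of v x] by (simp add: u_def)
    with v(1) show False by (simp add: Finite_Cartesian_Product.vec_eq_iff)
  qed
  have "(e * c i ^ 3 + (\<Sum>q\<in>UNIV. t i q * monomial_value c (s q))) * u 0 = 0" for i
  proof -
    \<comment> \<open>At the origin, each shifted value of \<open>u\<close> is a monomial in
      \<open>c\<close> times \<open>u 0\<close>.\<close>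
    have "F e i u 0 = 0"
      using E(1) by (simp add: u_def solutions_def)
    then have "e * (monomial_value c (e3 i) * u 0)
        + (\<Sum>q\<in>UNIV. t i q * (monomial_value c (s q) * u 0)) = 0"
      unfolding F_def S_def by (simp flip: geometric)
    then show ?thesis
      by (simp add: monomial_value_unit_index distrib_right sum_distrib_right mult.assoc)
  qed
  with \<open>u 0 \<noteq> 0\<close> show ?thesis by auto
qed

end

section \<open>Zeros of cubic maps\<close>

lemma cubic_map_nontrivial_zero:
  fixes P :: "real^'N \<Rightarrow> real^'n"
  assumes "cubic_map P" and card: "CARD('N) \<ge> CARD('n) + 1"
  shows "\<exists>x. x \<noteq> 0 \<and> P x = 0"
proof -
  obtain T where tri: "trilinear T" and sym: "symmetric3 T" and P: "\<And>x. P x = T x x x"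
    using assms(1) by (auto simp: cubic_map_def)
  have lin: "linear (\<lambda>x. T x y z)" "linear (\<lambda>x. T y x z)" "linear (\<lambda>x. T y z x)" for y z
    using tri by (simp_all add: trilinear_def)
  have cont: "continuous_on A P" for A
  proof -
    have "P = (\<lambda>x. T x x x)"
      using P by auto
    then show ?thesis
      using has_derivative_continuous [OF has_derivative_cubic [OF tri sym]]
      by (auto intro: continuous_at_imp_continuous_on)
  qed
  have P_scale: "P (c *\<^sub>R x) = c ^ 3 *\<^sub>R P x" for c x
    by (simp add: P linear_cmul [OF lin(1)] linear_cmul [OF lin(2)] linear_cmul [OF lin(3)]
        power3_eq_cube mult.assoc)
  \<comment> \<open>Here \<open>N \<ge> n + 1\<close> enters: \<open>Some i\<close> are the
    \<open>n\<close> unknowns and \<open>None\<close> is the variable set to 1, so its exponent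
    vector in \<open>\<mu>\<close> is 0.\<close>
  obtain \<iota> :: "'n option \<Rightarrow> 'N" where \<iota>: "inj \<iota>"
    using card_le_inj [of "UNIV :: 'n option set" "UNIV :: 'N set"] card by (auto simp: card_UNIV_option)
  obtain r :: "'n \<Rightarrow> nat" where r: "bij_betw r UNIV {0..<CARD('n)}"
    using ex_bij_betw_finite_nat [of "UNIV :: 'n set"] by auto
  define co :: "('n \<Rightarrow> real) \<Rightarrow> 'n option \<Rightarrow> real" where "co c = case_option 1 c" for c
  define \<mu> :: "'n option \<Rightarrow> 'n \<Rightarrow> nat" where "\<mu> = case_option 0 (unit_index 1)"
  define ax :: "'n option \<Rightarrow> real^'N" where "ax p = axis (\<iota> p) 1" for p
  \<comment> \<open>Monomials are indexed by triples of variables, so expanding \<open>T\<close>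
    trilinearly gives the coefficients directly.\<close>
  define s :: "'n option \<times> 'n option \<times> 'n option \<Rightarrow> 'n \<Rightarrow> nat"
    where "s = (\<lambda>(p, q, w). \<mu> p + \<mu> q + \<mu> w)"
  define t :: "'n \<Rightarrow> 'n option \<times> 'n option \<times> 'n option \<Rightarrow> real"
    where "t = (\<lambda>i (p, q, w). T (ax p) (ax q) (ax w) $ i)"
  have deg_\<mu>: "(\<Sum>i\<in>UNIV. \<mu> p i) \<le> 1" for p
    by (cases p) (simp_all add: \<mu>_def unit_index_def)
  interpret cubic_system r "CARD('n)" s t
  proof
    show "inj r" "r i < CARD('n)" for i
      using r by (auto simp: bij_betw_def)
    fix x :: "'n option \<times> 'n option \<times> 'n option"
    obtain p q w where x: "x = (p, q, w)" by (cases x)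
    show "(\<Sum>i\<in>UNIV. s x i) \<le> 3"
      using deg_\<mu> [of p] deg_\<mu> [of q] deg_\<mu> [of w] by (simp add: x s_def sum.distrib)
  qed
  define z where "z c = (\<Sum>p\<in>UNIV. co c p *\<^sub>R ax p)" for c
  have z_nth: "z c $ \<iota> p = co c p" for c p
  proof -
    have "z c $ \<iota> p = (\<Sum>p'\<in>UNIV. if p' = p then co c p else 0)"
      unfolding z_def sum_component using \<iota>
      by (intro sum.cong) (auto simp: ax_def axis_def dest: injD)
    then show ?thesis by simp
  qed
  have mon: "monomial_value c (\<mu> p) = co c p" for c p
    by (cases p) (simp_all add: \<mu>_def co_def monomial_value_unit_index del: One_nat_def,
        simp add: monomial_value_def)
  have expand: "T (z c) x y = (\<Sum>p\<in>UNIV. co c p *\<^sub>R T (ax p) x y)"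
    "T x (z c) y = (\<Sum>p\<in>UNIV. co c p *\<^sub>R T x (ax p) y)"
    "T x y (z c) = (\<Sum>p\<in>UNIV. co c p *\<^sub>R T x y (ax p))" for c x y
    by (simp_all add: z_def linear_sum [OF lin(1)] linear_sum [OF lin(2)] linear_sum [OF lin(3)]
        linear_cmul [OF lin(1)] linear_cmul [OF lin(2)] linear_cmul [OF lin(3)])
  have Pz: "P (z c) $ i = (\<Sum>q\<in>UNIV. t i q * monomial_value c (s q))" for c i
  proof -
    have "P (z c) = (\<Sum>p\<in>UNIV. \<Sum>q\<in>UNIV. \<Sum>w\<in>UNIV. (co c p * co c q * co c w) *\<^sub>R T (ax p) (ax q) (ax w))"
      unfolding P unfolding expand(1) unfolding expand(2) unfolding expand(3)
      by (simp add: scaleR_sum_right mult.assoc)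
    then have "P (z c) $ i = (\<Sum>p\<in>UNIV. \<Sum>q\<in>UNIV. \<Sum>w\<in>UNIV. t i (p, q, w) * monomial_value c (s (p, q, w)))"
      by (simp add: t_def s_def monomial_value_add mon mult_ac)
    then show ?thesis
      by (simp add: sum.cartesian_product UNIV_Times_UNIV [symmetric] case_prod_unfold del: UNIV_Times_UNIV)
  qed
  have small: "\<exists>y. norm y = 1 \<and> norm (P y) \<le> CARD('n) * e" if good: "good e" and "e > 0" for e :: real
  proof -
    obtain c :: "'n \<Rightarrow> real" where c: "\<And>i. e * c i ^ 3 + P (z c) $ i = 0"
      using good_imp_root [OF good] unfolding Pz by blast
    have "z c \<noteq> 0"
      using z_nth [of c None] by (auto simp: co_def)
    define m where "m = norm (z c)"
    have m: "m > 0" using \<open>z c \<noteq> 0\<close> by (simp add: m_def)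
    \<comment> \<open>After normalising, component \<open>i\<close> of \<open>P y\<close> is
      \<open>- e * (c i / m) ^ 3\<close>, and \<open>c i\<close> is a coordinate of
      \<open>z c\<close>, bounded by its norm \<open>m\<close>.\<close>
    define y where "y = inverse m *\<^sub>R z c"
    have "\<bar>P y $ i\<bar> \<le> e" for i
    proof -
      have "\<bar>c i\<bar> \<le> m"
        using component_le_norm_cart [of "z c" "\<iota> (Some i)"] by (simp add: z_nth co_def m_def)
      then have "\<bar>inverse m * c i\<bar> \<le> 1"
        using m by (simp add: abs_mult field_simps)
      then have "\<bar>inverse m * c i\<bar> ^ 3 \<le> 1"
        by (intro power_le_one) auto
      moreover have "P y $ i = - (e * (inverse m * c i) ^ 3)"
      proof -
        have "P (z c) $ i = - (e * c i ^ 3)"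
          using c [of i] by (simp add: eq_neg_iff_add_eq_0 add.commute)
        then show ?thesis
          by (simp add: y_def P_scale power_mult_distrib)
      qed
      ultimately show ?thesis
        using \<open>e > 0\<close> by (simp add: abs_mult power_abs mult_left_le)
    qed
    then have "norm (P y) \<le> (\<Sum>i\<in>(UNIV :: 'n set). e)"
      by (intro order_trans [OF norm_le_l1_cart] sum_mono) auto
    moreover have "norm y = 1"
      using m by (simp add: y_def m_def)
    ultimately show ?thesis by auto
  qed
  have "sphere (0 :: real^'N) 1 \<noteq> {}"
    by simp
  then obtain y0 :: "real^'N" where y0: "norm y0 = 1" "\<And>y. norm y = 1 \<Longrightarrow> norm (P y0) \<le> norm (P y)"
    using continuous_attains_inf [OF compact_sphere _ continuous_on_norm [OF cont], of 0 1] by auto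
  have "P y0 = 0"
  proof (rule ccontr)
    assume "P y0 \<noteq> 0"
    \<comment> \<open>Any good \<open>e\<close> below this threshold gives a value of norm below the
      minimum; one exists because an interval is uncountable.\<close>
    define d where "d = norm (P y0) / CARD('n)"
    have "d > 0" using \<open>P y0 \<noteq> 0\<close> by (simp add: d_def)
    then have "uncountable {0<..<d}"
      by (simp add: uncountable_open_interval)
    then have "\<not> {0<..<d} \<subseteq> {e. \<not> good e}"
      using countable_not_good countable_subset by blast
    then obtain e where e: "good e" "0 < e" "e < d" by auto
    then obtain y where y: "norm y = 1" "norm (P y) \<le> CARD('n) * e"
      using small by blast
    have "CARD('n) * e < norm (P y0)"
      using e(3) by (simp add: d_def field_simps)
    then show False using y0(2) [OF y(1)] y(2) by simp
  qed
  then show ?thesis using y0(1) by (intro exI [of _ y0]) auto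
qed

theorem theorem2p8:
  fixes P :: "real^'N \<Rightarrow> real^'n"
  assumes cubic: "cubic_map P"
    and i: "CARD('N) \<ge> CARD('n) + 1"
    and ii: "\<forall>l::real^'n \<Rightarrow> real. linear l \<and> l \<noteq> (\<lambda>y. 0) \<longrightarrow>
               \<not> (\<exists>x. x \<noteq> 0 \<and> (\<forall>i. isotropic (Qform P l i) x))"
  shows "\<exists>v. regular_zero P v"
proof -
  obtain T where tri: "trilinear T" and sym: "symmetric3 T" and "\<forall>x. P x = T x x x"
    using cubic by (auto simp: cubic_map_def)
  then have P: "P = (\<lambda>x. T x x x)" by auto
  obtain x where x: "x \<noteq> 0" "P x = 0"
    using cubic_map_nontrivial_zero [OF cubic i] by blast
  have "surj (differential P x)"
  proof (rule ccontr)
    assume not_surj: "\<not> surj (differential P x)"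
    have diff: "differential P x y = 3 *\<^sub>R T x x y" for y
      unfolding P by (rule differential_cubic [OF tri sym])
    have "linear (differential P x)"
      unfolding diff [abs_def] using tri by (intro linear_compose_scale_right) (simp add: trilinear_def)
    then have "subspace (range (differential P x))"
      by (simp add: linear_subspace_image)
    then have "span (range (differential P x)) \<noteq> UNIV"
      using not_surj by (metis span_eq_iff)
    from span_not_UNIV_orthogonal [OF this] obtain a
      where "a \<noteq> 0" and ortho: "\<forall>z\<in>span (range (differential P x)). inner a z = 0"
      by blast
    have a: "inner a (differential P x y) = 0" for y
      using ortho by (simp add: span_base)
    \<comment> \<open>With \<open>inner a\<close> as the functional, the form at \<open>x\<close>
      equals \<open>2 * inner a (differential P x (axis i 1))\<close>, which is zero.\<close>
    have "isotropic (Qform P (inner a) i) x" for i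
    proof -
      have "T (axis i 1) x x = T x x (axis i 1)"
        using sym unfolding symmetric3_def by metis
      then show ?thesis
        using a [of "axis i 1", unfolded diff]
        by (simp add: isotropic_def Qform_def P third_differential_cubic [OF tri sym])
    qed
    moreover have "linear (inner a)"
      by (intro bounded_linear.linear bounded_linear_inner_right)
    moreover have "inner a \<noteq> (\<lambda>y. 0)"
      using \<open>a \<noteq> 0\<close> by (metis inner_eq_zero_iff)
    ultimately show False
      using ii x(1) by blast
  qed
  with x(2) show ?thesis
    unfolding regular_zero_def by blast
qed

end
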